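(* Let $v,k,\lambda,b,r,\ell$ be positive integers with $k\leq v-2$ and $\ell$ dividing $v$, let $\Upsilon=\{n_1,\dots,n_b\}$ be a multiset of nonnegative integers, and let $\Upsilon'=\{\frac{v}{\ell}-n_1,\dots,\frac{v}{\ell}-n_b\}$. There exists a $(v,k,\lambda)$-BIBD with $b$ blocks and replication number $r$ together with an $\Upsilon$-LSE $\ell$-colouring of it in which all colour classes have the same size if and only if there exists a $(v,v-k,b-2r+\lambda)$-BIBD with an $\Upsilon'$-LSE $\ell$-colouring.
   Context: For positive integers $v,k,\lambda$ with $2\le k<v$, a $(v,k,\lambda)$-BIBD is a pair $(V,\mathcal{B})$ where $V$ is a set of $v$ points and $\mathcal{B}$ is a collection of $k$-element subsets of $V$ (blocks) such that every pair of distinct points lies in exactly $\lambda$ blocks; its replication number $r$ is the number of blocks containing any given point (equal to $\lambda(v-1)/(k-1)$). An $\ell$-colouring is a surjective map from $V$ onto a set $C$ of $\ell$ colours; the colour class of a colour is the set of points mapped to it. Given blocks $B_1,\dots,B_b$ and a multiset $\Upsilon=\{n_1,\dots,n_b\}$ of nonnegative integers ($n_i$ associated with $B_i$), an $\Upsilon$-LSE colouring is a colouring such that for each $i$: (1) some colour appears exactly $n_i$ times in $B_i$, and (2) for any two colours other than that colour, with colour classes $C_{j_1},C_{j_2}$, we have $\big||C_{j_1}\cap B_i|-|C_{j_2}\cap B_i|\big|\le 1$.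
   Formalization: The colour classes are required to have the same size on both sides of the equivalence, and r is assumed to satisfy r(k-1)=λ(v-1); without either of these the "if" direction fails (e.g. for the complete graph on 4 points). *)

theory Defs
  imports Main "HOL-Library.Multiset"
begin

text \<open>The blocks form a multiset, so that repeated blocks are allowed.\<close>

definition bibd :: "nat \<Rightarrow> nat \<Rightarrow> nat \<Rightarrow> 'a set \<Rightarrow> 'a set multiset \<Rightarrow> bool" where
  "bibd v k lam V \<B> \<longleftrightarrow>
     2 \<le> k \<and> k < v \<and> 0 < lam \<and>
     finite V \<and> card V = v \<and>
     (\<forall>B \<in># \<B>. B \<subseteq> V \<and> card B = k) \<and>
     (\<forall>x \<in> V. \<forall>y \<in> V. x \<noteq> y \<longrightarrow> size {# B \<in># \<B>. x \<in> B \<and> y \<in> B #} = lam)"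

definition replication_number :: "'a set \<Rightarrow> 'a set multiset \<Rightarrow> nat \<Rightarrow> bool" where
  "replication_number V \<B> r \<longleftrightarrow> (\<forall>x \<in> V. size {# B \<in># \<B>. x \<in> B #} = r)"

definition colouring :: "nat \<Rightarrow> 'a set \<Rightarrow> 'c set \<Rightarrow> ('a \<Rightarrow> 'c) \<Rightarrow> bool" where
  "colouring l V C f \<longleftrightarrow> finite C \<and> card C = l \<and> f ` V = C"

definition colour_class :: "'a set \<Rightarrow> ('a \<Rightarrow> 'c) \<Rightarrow> 'c \<Rightarrow> 'a set" where
  "colour_class V f c = {x \<in> V. f x = c}"

definition lse_block :: "'a set \<Rightarrow> 'c set \<Rightarrow> ('a \<Rightarrow> 'c) \<Rightarrow> 'a set \<Rightarrow> int \<Rightarrow> bool" where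
  "lse_block V C f B n \<longleftrightarrow>
     (\<exists>c \<in> C. int (card (colour_class V f c \<inter> B)) = n \<and>
        (\<forall>c1 \<in> C - {c}. \<forall>c2 \<in> C - {c}.
           \<bar>int (card (colour_class V f c1 \<inter> B)) - int (card (colour_class V f c2 \<inter> B))\<bar> \<le> 1))"

text \<open>
  The relator \<^const>\<open>rel_mset\<close> says that the blocks and the members of \<open>\<Upsilon>\<close> can be listed
  as \<open>B_1, \<dots>, B_b\<close> and \<open>n_1, \<dots>, n_b\<close> with \<open>n_i\<close> associated with \<open>B_i\<close>; in particular
  \<open>\<Upsilon>\<close> has as many members as there are blocks. The members of \<open>\<Upsilon>\<close> are integers so that
  differences \<open>v / l - n_i\<close> are not truncated; a negative one is never attained as a
  cardinality, so members of \<open>\<Upsilon>\<close> are automatically nonnegative.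
\<close>

definition lse_colouring ::
  "nat \<Rightarrow> int multiset \<Rightarrow> 'a set \<Rightarrow> 'a set multiset \<Rightarrow> 'c set \<Rightarrow> ('a \<Rightarrow> 'c) \<Rightarrow> bool" where
  "lse_colouring l \<Upsilon> V \<B> C f \<longleftrightarrow>
     colouring l V C f \<and> rel_mset (lse_block V C f) \<B> \<Upsilon>"

definition equal_classes :: "'a set \<Rightarrow> 'c set \<Rightarrow> ('a \<Rightarrow> 'c) \<Rightarrow> bool" where
  "equal_classes V C f \<longleftrightarrow>
     (\<forall>c \<in> C. \<forall>d \<in> C. card (colour_class V f c) = card (colour_class V f d))"

text \<open>
  In the theorem, \<open>r\<close> is the replication number that the parameters \<open>(v, k, \<lambda>)\<close> determine,
  \<open>r (k - 1) = \<lambda> (v - 1)\<close>. This identity holds in every \<open>(v, k, \<lambda>)\<close>-BIBD with replication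
  number \<open>r\<close>, but has to be assumed for the converse: \<open>(v, k, \<lambda>, b, r) = (4, 2, 3, 6, 4)\<close>
  gives \<open>b - 2 r + \<lambda> = 1\<close>, and a \<open>(4, 2, 1)\<close>-BIBD has 6 blocks but a \<open>(4, 2, 3)\<close>-BIBD
  has 18.

  Equal colour classes are required on both sides. Without this on the right, the complete
  graph on 4 points coloured with classes of sizes 1 and 3 is a counterexample to the
  converse: it is LSE for \<open>{1, 1, 1, 0, 0, 0}\<close>, whereas with two classes of size 2 exactly
  four of the six edges meet both colours, so \<open>{1, 1, 1, 2, 2, 2}\<close> is impossible.

  A value \<open>b - 2 r + \<lambda> \<le> 0\<close> becomes 0 under \<^const>\<open>nat\<close>, and no BIBD has index 0. Finite
  designs and colour sets may be taken inside the natural numbers without loss of generality.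
\<close>

end

theory Submission
  imports Defs
begin

text \<open>
  Both directions replace every block by its complement and keep the colouring. Since every
  colour class has \<open>v / l\<close> points, a colour occurring \<open>n\<close> times in \<open>B\<close> occurs \<open>v / l - n\<close> times
  in \<open>V - B\<close>, so differences between colours only change sign. For the converse the given
  design must be shown to have replication number \<open>b - r\<close>: its index \<open>b - 2 r + \<lambda>\<close> together
  with \<open>r (k - 1) = \<lambda> (v - 1)\<close> forces \<open>b k = v r\<close>.
\<close>

text \<open>Double counting of the pairs \<open>(B, y)\<close> with \<open>P B y\<close>, repeated
  blocks counted repeatedly. It serves for the blocks through a fixed point and for all
  blocks.\<close>

lemma sum_mset_card_eq_sum_size:
  assumes "finite A"
  shows "(\<Sum>B\<in>#M. card {y \<in> A. P B y}) = (\<Sum>y\<in>A. size {#B \<in># M. P B y#})"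
proof (induction M)
  case empty
  show ?case by simp
next
  case (add B M)
  have "card {y \<in> A. P B y} = (\<Sum>y\<in>A. if P B y then 1 else 0)"
    using assms by (simp add: sum.If_cases Int_def)
  moreover have "size {#B' \<in># add_mset B M. P B' y#}
      = (if P B y then 1 else 0) + size {#B' \<in># M. P B' y#}" for y
    by simp
  ultimately show ?case
    by (simp only: sum.distrib add.IH image_mset_add_mset sum_mset.add_mset)
qed

text \<open>The first equation counts pairs \<open>(B, y)\<close> with \<open>x\<close> and
  \<open>y\<close> in \<open>B\<close> and \<open>y\<close> distinct from a fixed \<open>x\<close>;
  the second counts all incident pairs.\<close>

lemma bibd_replication:
  assumes "bibd v k lam V \<B>"
  obtains r where "replication_number V \<B> r" "r * (k - 1) = lam * (v - 1)" "size \<B> * k = v * r"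
proof -
  from assms have k: "2 \<le> k" and fin: "finite V" and v: "card V = v"
    and blocks: "\<And>B. B \<in># \<B> \<Longrightarrow> B \<subseteq> V \<and> card B = k"
    and pairs: "\<And>x y. x \<in> V \<Longrightarrow> y \<in> V \<Longrightarrow> x \<noteq> y \<Longrightarrow> size {# B \<in># \<B>. x \<in> B \<and> y \<in> B #} = lam"
    unfolding bibd_def by auto
  have local_count: "size {# B \<in># \<B>. x \<in> B #} * (k - 1) = lam * (v - 1)" if x: "x \<in> V" for x
  proof -
    let ?N = "{# B \<in># \<B>. x \<in> B #}"
    have "card {y \<in> V - {x}. y \<in> B} = k - 1" if "B \<in># ?N" for B
    proof -
      from that blocks have B: "B \<subseteq> V" "card B = k" "x \<in> B" by auto
      then have "{y \<in> V - {x}. y \<in> B} = B - {x}" by auto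
      with B show ?thesis by simp
    qed
    then have "(\<Sum>B\<in>#?N. card {y \<in> V - {x}. y \<in> B}) = (\<Sum>B\<in>#?N. k - 1)"
      by (intro arg_cong[where f = sum_mset] image_mset_cong) auto
    then have "size ?N * (k - 1) = (\<Sum>y\<in>V - {x}. size {# B \<in># ?N. y \<in> B #})"
      using fin sum_mset_card_eq_sum_size[of "V - {x}" "\<lambda>B y. y \<in> B" ?N] by simp
    also have "\<dots> = (\<Sum>y\<in>V - {x}. lam)"
    proof (rule sum.cong)
      fix y assume "y \<in> V - {x}"
      then show "size {# B \<in># ?N. y \<in> B #} = lam"
        using pairs[of x y] x by (auto simp: filter_filter_mset conj_commute)
    qed simp
    finally show ?thesis using fin v x by simp
  qed
  \<comment> \<open>The right side of \<open>local_count\<close> does not involve \<open>x\<close>,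
    and \<open>k - 1\<close> is positive, so the division is exact and gives the same count at every
    point.\<close>
  define r where "r = lam * (v - 1) div (k - 1)"
  have r: "size {# B \<in># \<B>. x \<in> B #} = r" if "x \<in> V" for x
    using local_count[OF that, symmetric] k by (simp add: r_def)
  have "card V \<noteq> 0" using assms unfolding bibd_def by auto
  then obtain x where "x \<in> V" by fastforce
  then have "r * (k - 1) = lam * (v - 1)" using local_count r by metis
  moreover have "size \<B> * k = v * r"
  proof -
    have "card {y \<in> V. y \<in> B} = k" if "B \<in># \<B>" for B
      using blocks[OF that] by (auto simp: Int_absorb1 Int_def[symmetric])
    then have "(\<Sum>B\<in>#\<B>. card {y \<in> V. y \<in> B}) = (\<Sum>B\<in>#\<B>. k)"
      by (intro arg_cong[where f = sum_mset] image_mset_cong) auto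
    then show ?thesis
      using fin r v sum_mset_card_eq_sum_size[of V "\<lambda>B y. y \<in> B" \<B>] by simp
  qed
  ultimately show ?thesis using r that unfolding replication_number_def by blast
qed

text \<open>Inclusion-exclusion, stated over \<open>int\<close> so that no subtraction
  truncates.\<close>

lemma size_filter_neither:
  "int (size {# B \<in># M. x \<notin> B \<and> y \<notin> B #}) =
     int (size M) - int (size {# B \<in># M. x \<in> B #}) - int (size {# B \<in># M. y \<in> B #})
     + int (size {# B \<in># M. x \<in> B \<and> y \<in> B #})"
  by (induction M) auto

lemma replication_number_complement:
  assumes "replication_number V \<B> r"
  shows "replication_number V (image_mset (\<lambda>B. V - B) \<B>) (size \<B> - r)"
  unfolding replication_number_def
proof
  fix x assume x: "x \<in> V"
  then have "{# B \<in># image_mset (\<lambda>B. V - B) \<B>. x \<in> B #}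
      = image_mset (\<lambda>B. V - B) {# B \<in># \<B>. x \<notin> B #}"
    by (simp add: filter_mset_image_mset)
  moreover have "size {# B \<in># \<B>. x \<in> B #} = r"
    using assms x unfolding replication_number_def by blast
  moreover have "size \<B> = size {# B \<in># \<B>. x \<in> B #} + size {# B \<in># \<B>. x \<notin> B #}"
    by (metis multiset_partition size_union)
  ultimately show "size {# B \<in># image_mset (\<lambda>B. V - B) \<B>. x \<in> B #} = size \<B> - r"
    by simp
qed

text \<open>Two points lie in the complement of \<open>B\<close> exactly when \<open>B\<close>
  misses both, so inclusion-exclusion gives the index. The bound \<open>k + 2 \<le> v\<close> gives
  each complement at least two points.\<close>

lemma bibd_complement:
  assumes "bibd v k lam V \<B>" and "replication_number V \<B> r" and "k + 2 \<le> v"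
    and "int lam' = int (size \<B>) - 2 * int r + int lam" and "0 < lam'"
  shows "bibd v (v - k) lam' V (image_mset (\<lambda>B. V - B) \<B>)"
proof -
  from assms(1) have fin: "finite V" and v: "card V = v" and k: "2 \<le> k"
    and blocks: "\<And>B. B \<in># \<B> \<Longrightarrow> B \<subseteq> V \<and> card B = k"
    and pairs: "\<And>x y. x \<in> V \<Longrightarrow> y \<in> V \<Longrightarrow> x \<noteq> y \<Longrightarrow> size {# B \<in># \<B>. x \<in> B \<and> y \<in> B #} = lam"
    unfolding bibd_def by auto
  have "card (V - B) = v - k" if "B \<in># \<B>" for B
    using blocks[OF that] fin v by (auto simp: card_Diff_subset finite_subset)
  moreover have "size {# B \<in># image_mset (\<lambda>B. V - B) \<B>. x \<in> B \<and> y \<in> B #} = lam'"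
    if xy: "x \<in> V" "y \<in> V" "x \<noteq> y" for x y
  proof -
    have "{# B \<in># image_mset (\<lambda>B. V - B) \<B>. x \<in> B \<and> y \<in> B #}
        = image_mset (\<lambda>B. V - B) {# B \<in># \<B>. x \<notin> B \<and> y \<notin> B #}"
      using xy by (simp add: filter_mset_image_mset)
    moreover have "int (size {# B \<in># \<B>. x \<notin> B \<and> y \<notin> B #}) = int lam'"
      using xy assms(2,4) pairs unfolding size_filter_neither replication_number_def by simp
    ultimately show ?thesis by simp
  qed
  ultimately show ?thesis
    using assms(3,5) fin v k unfolding bibd_def by auto
qed

text \<open>The \<open>l\<close> colour classes partition \<open>V\<close> and have equal
  size.\<close>

lemma card_equal_class:
  assumes "finite V" and "colouring l V C f" and "equal_classes V C f" and "c \<in> C"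
  shows "card (colour_class V f c) = card V div l"
proof -
  from assms(2) have C: "finite C" "card C = l" "f ` V = C" unfolding colouring_def by auto
  have "card V = (\<Sum>d\<in>C. card (colour_class V f d))"
    using sum.image_gen[of V "\<lambda>_. 1::nat" f] assms(1) C by (simp add: colour_class_def)
  also have "\<dots> = (\<Sum>d\<in>C. card (colour_class V f c))"
    using assms(3,4) unfolding equal_classes_def by (intro sum.cong refl) blast
  finally have "card V = l * card (colour_class V f c)" using C(2) by simp
  moreover have "l \<noteq> 0" using C(1,2) assms(4) by (auto simp: card_gt_0_iff)
  ultimately show ?thesis by simp
qed

lemma lse_colouring_complement:
  assumes "finite V" and "\<forall>B \<in># \<B>. B \<subseteq> V" and "equal_classes V C f"
    and "lse_colouring l \<Upsilon> V \<B> C f"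
  shows "lse_colouring l (image_mset (\<lambda>n. int (card V div l) - n) \<Upsilon>) V
           (image_mset (\<lambda>B. V - B) \<B>) C f"
proof -
  from assms(4) have col: "colouring l V C f" and rel: "rel_mset (lse_block V C f) \<B> \<Upsilon>"
    unfolding lse_colouring_def by auto
  have "int (card (colour_class V f c \<inter> (V - B)))
      = int (card V div l) - int (card (colour_class V f c \<inter> B))" if "c \<in> C" for c B
  proof -
    have "colour_class V f c \<inter> (V - B) = colour_class V f c - colour_class V f c \<inter> B"
      and fin: "finite (colour_class V f c)"
      using assms(1) by (auto simp: colour_class_def)
    then show ?thesis
      using card_equal_class[OF assms(1) col assms(3) that]
      using card_mono[OF fin, of "colour_class V f c \<inter> B"]
      by (simp add: card_Diff_subset of_nat_diff)
  qed
  \<comment> \<open>The same exceptional colour serves for the complement.\<close>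
  then have "lse_block V C f (V - B) (int (card V div l) - n)"
    if "lse_block V C f B n" for B n
    using that unfolding lse_block_def by fastforce
  then have "rel_mset (lse_block V C f) (image_mset (\<lambda>B. V - B) \<B>)
      (image_mset (\<lambda>n. int (card V div l) - n) \<Upsilon>)"
    unfolding multiset.rel_map by (rule multiset.rel_mono_strong[OF rel])
  with col show ?thesis unfolding lse_colouring_def by blast
qed

text \<open>The left side vanishes in a design with \<open>b\<close> blocks of size
  \<open>v - k\<close> and index \<open>b - 2 * r + lam\<close>: both terms count triples of a block
  and two distinct points in it, in order. The right side is built from the defects of the two
  counting equations for \<open>k\<close>, \<open>lam\<close> and \<open>r\<close>.\<close>

lemma complement_index_identity:
  fixes v k lam b r :: int
  shows "b * ((v - k) * (v - k - 1)) - v * (v - 1) * (b - 2 * r + lam)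
      = (v * r - b * k) * (2 * v - k - 1) + v * (r * (k - 1) - lam * (v - 1))"
  by (simp add: algebra_simps)

text \<open>The last two hypotheses are the counting equations of a design with block size
  \<open>v - k\<close> and replication number \<open>s\<close>. They make the left side of the
  identity vanish; since \<open>2 * v - k - 1\<close> is nonzero, \<open>b * k = v * r\<close>
  follows, and with it \<open>s\<close>.\<close>

lemma replication_from_complement_index:
  fixes v k lam b r s :: int
  assumes "0 < v" and "k < v" and "r * (k - 1) = lam * (v - 1)"
    and "b * (v - k) = v * s" and "s * (v - k - 1) = (b - 2 * r + lam) * (v - 1)"
  shows "s = b - r"
proof -
  have "b * ((v - k) * (v - k - 1)) = v * s * (v - k - 1)"
    by (simp only: assms(4)[symmetric] mult.assoc)
  also have "\<dots> = v * (v - 1) * (b - 2 * r + lam)"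
    by (simp only: assms(5) mult.assoc mult.commute[of "v - 1"])
  finally have "(v * r - b * k) * (2 * v - k - 1) = 0"
    using complement_index_identity[of b v k r lam] assms(3) by simp
  moreover have "2 * v - k - 1 \<noteq> 0" using assms(1,2) by linarith
  ultimately have "b * k = v * r" by simp
  then have "v * s = v * (b - r)" using assms(4) by (simp add: right_diff_distrib mult.commute)
  then show ?thesis using assms(1) by simp
qed

theorem theorem2p6:
  fixes v k lam b r l :: nat and \<Upsilon> :: "int multiset"
  assumes "0 < v" "0 < k" "0 < lam" "0 < b" "0 < r" "0 < l"
    and "k + 2 \<le> v"
    and "l dvd v"
    and "r * (k - 1) = lam * (v - 1)"
    and "size \<Upsilon> = b"
    and "\<forall>n \<in># \<Upsilon>. 0 \<le> n"
  shows
    "(\<exists>(V :: nat set) \<B> (C :: nat set) f.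
        bibd v k lam V \<B> \<and> size \<B> = b \<and> replication_number V \<B> r \<and>
        lse_colouring l \<Upsilon> V \<B> C f \<and> equal_classes V C f)
     \<longleftrightarrow>
     (\<exists>(V :: nat set) \<B> (C :: nat set) f.
        bibd v (v - k) (nat (int b - 2 * int r + int lam)) V \<B> \<and>
        lse_colouring l (image_mset (\<lambda>n. int (v div l) - n) \<Upsilon>) V \<B> C f \<and>
        equal_classes V C f)"
  (is "?L \<longleftrightarrow> ?R")
proof
  assume ?L
  then obtain V :: "nat set" and \<B> and C :: "nat set" and f
    where D: "bibd v k lam V \<B>" "size \<B> = b" "replication_number V \<B> r"
      and col: "lse_colouring l \<Upsilon> V \<B> C f" "equal_classes V C f" by blast
  obtain s where s: "replication_number V \<B> s" "size \<B> * k = v * s"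
    using bibd_replication[OF D(1)] by metis
  from D(1) have V: "finite V" "card V = v" "\<forall>B \<in># \<B>. B \<subseteq> V" and k: "2 \<le> k"
    unfolding bibd_def by auto
  from V assms(1) have "V \<noteq> {}" by auto
  \<comment> \<open>A nonempty \<open>V\<close> has only one replication number, so the equation for
    \<open>s\<close> becomes one for \<open>r\<close>.\<close>
  with s(1) D(3) have "s = r" unfolding replication_number_def by fastforce
  with s(2) D(2) have "int b * int k = int v * int r" by (metis of_nat_mult)
  moreover have "int r * (int k - 1) = int lam * (int v - 1)"
    using arg_cong[OF assms(9), of int] k assms(7) by (simp add: of_nat_diff)
  \<comment> \<open>Both defects vanish here. The left side is positive because
    \<open>k + 2 \<le> v\<close>, hence so is the index, and \<open>nat\<close> does not truncate
    it.\<close>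
  ultimately have "int b * ((int v - int k) * (int v - int k - 1))
      = int v * (int v - 1) * (int b - 2 * int r + int lam)" 
    using complement_index_identity[of "int b" "int v" "int k" "int r" "int lam"] by simp
  moreover have "0 < int b * ((int v - int k) * (int v - int k - 1))"
    and "0 < int v * (int v - 1)" using assms by simp_all
  ultimately have "0 < int b - 2 * int r + int lam" by (metis zero_less_mult_pos)
  with D assms(7) have "bibd v (v - k) (nat (int b - 2 * int r + int lam)) V
      (image_mset (\<lambda>B. V - B) \<B>)" by (intro bibd_complement) auto
  with lse_colouring_complement[OF V(1,3) col(2,1)] col(2) V(2) show ?R by blast
next
  assume ?R
  then obtain V :: "nat set" and \<B> and C :: "nat set" and f
    where D: "bibd v (v - k) (nat (int b - 2 * int r + int lam)) V \<B>"
      and col: "lse_colouring l (image_mset (\<lambda>n. int (v div l) - n) \<Upsilon>) V \<B> C f"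
        "equal_classes V C f" by blast
  from D have V: "finite V" "card V = v" "\<forall>B \<in># \<B>. B \<subseteq> V"
    and pos: "0 < int b - 2 * int r + int lam"
    unfolding bibd_def by auto
  \<comment> \<open>The number of blocks is read off from \<open>\<Upsilon>\<close>, since
    \<open>rel_mset\<close> relates only multisets of equal size.\<close>
  have b: "size \<B> = b"
    using col(1) assms(10) unfolding lse_colouring_def by (metis rel_mset_size size_image_mset)
  \<comment> \<open>This excludes \<open>k = 1\<close>, which would make the product 0.\<close>
  have "0 < r * (k - 1)" using assms(3,7,9) by simp
  then have k: "2 \<le> k" by (cases k) auto
  obtain s where s: "replication_number V \<B> s"
      "s * (v - k - 1) = nat (int b - 2 * int r + int lam) * (v - 1)" "size \<B> * (v - k) = v * s"
    using bibd_replication[OF D] by metis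
  have "int s = int b - int r"
  proof (rule replication_from_complement_index)
    show "int r * (int k - 1) = int lam * (int v - 1)"
      using arg_cong[OF assms(9), of int] k assms(7) by (simp add: of_nat_diff)
    show "int b * (int v - int k) = int v * int s"
      using arg_cong[OF s(3), of int] b assms(7) by (simp add: of_nat_diff)
    show "int s * (int v - int k - 1) = (int b - 2 * int r + int lam) * (int v - 1)"
      using arg_cong[OF s(2), of int] pos assms(7) by (simp add: of_nat_diff diff_diff_eq add.commute)
  qed (use assms(1,7) in auto)
  \<comment> \<open>With \<open>s = b - r\<close>, complementing the given design restores
    \<open>r\<close> and \<open>lam\<close>:
    \<open>b - 2 * (b - r) + (b - 2 * r + lam) = lam\<close>.\<close>
  then have r: "size \<B> - s = r" and "int lam = int (size \<B>) - 2 * int s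
      + int (nat (int b - 2 * int r + int lam))" using b pos by auto
  then have "bibd v k lam V (image_mset (\<lambda>B. V - B) \<B>)"
    using bibd_complement[OF D s(1), of lam] k assms(3,7) by simp
  moreover have "replication_number V (image_mset (\<lambda>B. V - B) \<B>) r"
    using replication_number_complement[OF s(1)] r by simp
  \<comment> \<open>Subtracting twice from \<open>v div l\<close> over the integers gives back
    \<open>\<Upsilon>\<close>.\<close>
  moreover have "lse_colouring l \<Upsilon> V (image_mset (\<lambda>B. V - B) \<B>) C f"
    using lse_colouring_complement[OF V(1,3) col(2,1)] V(2)
    by (simp add: multiset.map_comp comp_def)
  moreover have "size (image_mset (\<lambda>B. V - B) \<B>) = b" using b by simp
  ultimately show ?L using col(2) by blast
qed

end
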